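(* Let $k\in\mathbb{N}$ with $k\ge 2$. For sufficiently smooth velocity components $u,v$, the flux difference $\frac{1}{\Delta y}\left(F^{u,y}_{i,j+1}-F^{u,y}_{i,j}\right)$ produced by the staggered flux algorithm $\mathcal{A}_k$ (defined in the context) is an at most second order approximation to $\frac{\partial}{\partial y}(uv)(x_i,y_{j+\frac12})$. That is, its order of accuracy (as defined in the context) does not exceed $2$, for every $k\ge 2$. Hence the staggered semi-discrete WENO scheme described in the context, which uses $\mathcal{A}_k$ for the mixed fluxes, is at most second order accurate, and the relation $$\frac{1}{\Delta y}\left(F^{u,y}_{i,j+1}-F^{u,y}_{i,j}\right)=\frac{\partial}{\partial y}(uv)(x_i,y_{j+\frac12})+O(\Delta x^{2k-1}+\Delta y^{2k-1})\qquad\text{for all } i,j$$ does not hold for general sufficiently smooth $u,v$.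
   Context: **Grid.** Take a uniform two-dimensional grid with spacings $\Delta x,\Delta y>0$, $x_{i}=x_{\min}+i\Delta x$, $y_j=y_{\min}+j\Delta y$, where the index may also be a half-integer. Variables are staggered (Arakawa-C grid): $u_{i,j+\frac12}=u(x_i,y_{j+\frac12})$ and $v_{i+\frac12,j}=v(x_{i+\frac12},y_j)$ are the available exact point values of the smooth functions $u,v$. Boundaries play no role. **WENO-$(2k-1)$ reconstruction operators** $W_{\pm\frac12}:\mathbb{R}^{2k-1}\to\mathbb{R}$. On a uniform one-dimensional grid with cells $C_j$ centered at $x_j$, let $\bar w_j$ be numbers regarded as cell averages. - For $r\in\{0,\dots,k-1\}$ let $w^{(r)}_{j+\frac12}=\sum_{l=0}^{k-1}c_{rl}\,\bar w_{j-r+l}$ be the value at the right edge $x_{j+\frac12}$ of the unique polynomial of degree at most $k-1$ whose averages over $C_{j-r},\dots,C_{j-r+k-1}$ are $\bar w_{j-r},\dots,\bar w_{j-r+k-1}$. - Then $W_{+\frac12}(\bar w_{j-(k-1)},\dots,\bar w_{j+(k-1)})=\sum_{r=0}^{k-1}\omega_r w^{(r)}_{j+\frac12}$ with $\omega_r\propto \frac{d_r}{(\epsilon+\beta_r)^2}$, normalized so that $\sum_r\omega_r=1$. Here $\epsilon>0$ is a small constant and $\beta_r\ge0$ is a smoothness indicator of the data on the $r$-th stencil ($\beta_r\approx 0$ if the data are smooth there, $\beta_r=O(1)$ otherwise). The $d_r>0$ are the fixed linear weights for which the combination $\sum_r d_r w^{(r)}_{j+\frac12}$ is $(2k-1)$-th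 order accurate. - $W_{-\frac12}$ is the mirror image of $W_{+\frac12}$ and approximates the value at the left edge $x_{j-\frac12}$. - If $\bar w_j$ are the cell averages of a sufficiently regular function $w$, then $W_{\pm\frac12}(\bar w_{j-(k-1)},\dots,\bar w_{j+(k-1)})=w(x_{j\pm\frac12})+O(\Delta x^{2k-1})$. In the finite difference setting these operators are applied to point values. **The staggered flux algorithm $\mathcal{A}_k$** computes $F^{u,y}_{i,j+1}$ for all $i,j$ as follows. 1. Let $\tilde v_{i,j+1}$ be the value at $x_i$ of the one-dimensional central (Lagrange) interpolation polynomial in $x$ through the symmetric $2k$-point data $\{v_{i-\frac12+l,\,j+1}\}_{l=-k+1}^{k}$, so that $\tilde v_{i,j+1}=v(x_i,y_{j+1})+O(\Delta x^{2k})$. 2. Compute the two biased vertical reconstructions $\hat u^-_{i,j+1}=W_{+\frac12}(u_{i,j+\frac12+(-k+1)},\dots,u_{i,j+\frac12+k-1})$ and $\hat u^+_{i,j+1}=W_{-\frac12}(u_{i,j+\frac12+(-k+2)},\dots,u_{i,j+\frac12+k})$. 3. Set $\hat u_{i,j+1}=\hat u^+_{i,j+1}$ if $\tilde v_{i,j+1}<0$, and $\hat u_{i,j+1}=\hat u^-_{i,j+1}$ if $\tilde v_{i,j+1}\ge0$. 4. Set $F^{u,y}_{i,j+1}:=\tilde v_{i,j+1}\hat u_{i,j+1}$. **The semi-discrete scheme** approximates $\partial_t u=-\partial_x(u^2)-\partial_y(uv)$, $\partial_t v=-\partial_x(uv)-\partial_y(v^2)$. Its first equation is $$\tfrac{d}{dt}u_{i,j+\frac12}=-\tfrac1{\Delta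 x}\left(F^{u,x}_{i+\frac12,j+\frac12}-F^{u,x}_{i-\frac12,j+\frac12}\right)-\tfrac1{\Delta y}\left(F^{u,y}_{i,j+1}-F^{u,y}_{i,j}\right).$$ Here $F^{u,x}_{i+\frac12,j+\frac12}$ is a (biased, upwinded) WENO-$(2k-1)$ reconstruction in the $x$-direction from the point values $u^2_{i,j+\frac12}$, and $F^{u,y}$ is given by $\mathcal{A}_k$. The second equation is discretized analogously with the roles of $(u,x)$ and $(v,y)$ interchanged. **Order of accuracy.** The order of accuracy of a discrete approximation is the largest $p$ such that, for all sufficiently smooth $u,v$, the truncation error (the difference between the discrete expression evaluated on exact point values and the exact differential expression at the same point) is $O(\Delta x^{p}+\Delta y^{p})$ as $\Delta x,\Delta y\to0$. "At most second order" means $p\le2$. *)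

theory Defs
  imports
    "HOL-Analysis.Analysis"
    "HOL-Computational_Algebra.Polynomial"
    "HOL-Library.Landau_Symbols"
begin

section \<open>Smooth functions\<close>

definition smooth1 :: "(real \<Rightarrow> real) \<Rightarrow> bool" where
  "smooth1 w \<longleftrightarrow> (\<forall>n x. (deriv ^^ n) w field_differentiable at x)"

text \<open>All partial derivatives up to order \<open>n\<close> exist and are continuous on the plane.\<close>

primrec cont_diff2 :: "nat \<Rightarrow> (real \<Rightarrow> real \<Rightarrow> real) \<Rightarrow> bool" where
  "cont_diff2 0 f \<longleftrightarrow> continuous_on UNIV (\<lambda>(x, y). f x y)"
| "cont_diff2 (Suc n) f \<longleftrightarrow>
     continuous_on UNIV (\<lambda>(x, y). f x y) \<and>
     (\<exists>fx fy. (\<forall>x y. ((\<lambda>s. f s y) has_real_derivative fx x y) (at x)) \<and>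
              (\<forall>x y. ((\<lambda>s. f x s) has_real_derivative fy x y) (at y)) \<and>
              cont_diff2 n fx \<and> cont_diff2 n fy)"

definition smooth2 :: "(real \<Rightarrow> real \<Rightarrow> real) \<Rightarrow> bool" where
  "smooth2 f \<longleftrightarrow> (\<forall>n. cont_diff2 n f)"


section \<open>WENO reconstruction\<close>

definition cell_average :: "(real \<Rightarrow> real) \<Rightarrow> real \<Rightarrow> real \<Rightarrow> real" where
  "cell_average w h x = integral {x - h / 2 .. x + h / 2} w / h"

text \<open>
  Data on a one-dimensional grid are functions \<open>w :: int \<Rightarrow> real\<close> indexed relative to the cell
  in which the reconstruction takes place, so \<open>w m\<close> stands for \<open>w\<^sub>j\<^sub>+\<^sub>m\<close>. The coefficients
  \<open>c\<^sub>r\<^sub>l\<close> of a uniform grid are invariant under translation and scaling, hence the polynomial is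
  taken on the reference grid with unit cells centred at the integers; the right edge of the
  reconstruction cell is the point 1/2.
\<close>

definition stencil_poly :: "nat \<Rightarrow> nat \<Rightarrow> (int \<Rightarrow> real) \<Rightarrow> real poly" where
  "stencil_poly k r w = (THE p. degree p \<le> k - 1 \<and>
     (\<forall>l<k. cell_average (poly p) 1 (of_int (int l - int r)) = w (int l - int r)))"

definition stencil_value :: "nat \<Rightarrow> nat \<Rightarrow> (int \<Rightarrow> real) \<Rightarrow> real" where
  "stencil_value k r w = poly (stencil_poly k r w) (1 / 2)"

definition linear_weights :: "nat \<Rightarrow> (nat \<Rightarrow> real) \<Rightarrow> bool" where
  "linear_weights k d \<longleftrightarrow>
     (\<forall>r<k. d r > 0) \<and>
     (\<forall>w x. smooth1 w \<longrightarrow>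
        (\<lambda>h. (\<Sum>r<k. d r * stencil_value k r (\<lambda>m. cell_average w h (x + of_int m * h)))
              - w (x + h / 2))
          \<in> O[at_right 0](\<lambda>h. h ^ (2 * k - 1)))"

text \<open>
  \<open>\<beta> r\<close> maps the list of the \<open>k\<close> data values on the \<open>r\<close>-th stencil to its smoothness indicator.
  No particular indicator is fixed: \<open>\<beta>\<close> remains an arbitrary nonnegative parameter.
\<close>

definition weno_alpha ::
  "nat \<Rightarrow> real \<Rightarrow> (nat \<Rightarrow> real) \<Rightarrow> (nat \<Rightarrow> real list \<Rightarrow> real) \<Rightarrow> (int \<Rightarrow> real) \<Rightarrow> nat \<Rightarrow> real" where
  "weno_alpha k \<epsilon> d \<beta> w r = d r / (\<epsilon> + \<beta> r (map (\<lambda>l. w (int l - int r)) [0..<k]))\<^sup>2"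

definition weno_weight ::
  "nat \<Rightarrow> real \<Rightarrow> (nat \<Rightarrow> real) \<Rightarrow> (nat \<Rightarrow> real list \<Rightarrow> real) \<Rightarrow> (int \<Rightarrow> real) \<Rightarrow> nat \<Rightarrow> real" where
  "weno_weight k \<epsilon> d \<beta> w r = weno_alpha k \<epsilon> d \<beta> w r / (\<Sum>s<k. weno_alpha k \<epsilon> d \<beta> w s)"

definition weno_right ::
  "nat \<Rightarrow> real \<Rightarrow> (nat \<Rightarrow> real) \<Rightarrow> (nat \<Rightarrow> real list \<Rightarrow> real) \<Rightarrow> (int \<Rightarrow> real) \<Rightarrow> real" where
  "weno_right k \<epsilon> d \<beta> w = (\<Sum>r<k. weno_weight k \<epsilon> d \<beta> w r * stencil_value k r w)"

definition weno_left ::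
  "nat \<Rightarrow> real \<Rightarrow> (nat \<Rightarrow> real) \<Rightarrow> (nat \<Rightarrow> real list \<Rightarrow> real) \<Rightarrow> (int \<Rightarrow> real) \<Rightarrow> real" where
  "weno_left k \<epsilon> d \<beta> w = weno_right k \<epsilon> d \<beta> (\<lambda>m. w (- m))"


section \<open>Staggered fluxes\<close>

text \<open>
  Staggered data: \<open>U i j\<close> stands for \<open>u\<^sub>i\<^sub>,\<^sub>j\<^sub>+\<^sub>1\<^sub>/\<^sub>2\<close> and \<open>V i j\<close> for \<open>v\<^sub>i\<^sub>+\<^sub>1\<^sub>/\<^sub>2\<^sub>,\<^sub>j\<close>. Thus the
  value \<open>v\<close> at the half-integer index \<open>i - 1/2 + l\<close> is \<open>V (i - 1 + l) j\<close>. The interpolation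
  polynomial is written in the coordinate \<open>(x - x\<^sub>i) / \<Delta>x\<close>.
\<close>

definition interp_poly :: "nat \<Rightarrow> (int \<Rightarrow> int \<Rightarrow> real) \<Rightarrow> int \<Rightarrow> int \<Rightarrow> real poly" where
  "interp_poly k V i j = (THE p. degree p \<le> 2 * k - 1 \<and>
     (\<forall>l\<in>{- int k + 1 .. int k}. poly p (of_int l - 1 / 2) = V (i - 1 + l) j))"

definition v_interp :: "nat \<Rightarrow> (int \<Rightarrow> int \<Rightarrow> real) \<Rightarrow> int \<Rightarrow> int \<Rightarrow> real" where
  "v_interp k V i j = poly (interp_poly k V i j) 0"

text \<open>
  The flux \<open>F\<^sup>u\<^sup>,\<^sup>y\<close> at \<open>(x\<^sub>i, y\<^sub>j)\<close>. This point is the right (upper) edge of the cell centred at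
  \<open>y\<^sub>j\<^sub>-\<^sub>1\<^sub>/\<^sub>2\<close>, whose datum is \<open>U i (j - 1)\<close>, and the left (lower) edge of the cell centred at
  \<open>y\<^sub>j\<^sub>+\<^sub>1\<^sub>/\<^sub>2\<close>.
\<close>

definition mixed_flux ::
  "nat \<Rightarrow> real \<Rightarrow> (nat \<Rightarrow> real) \<Rightarrow> (nat \<Rightarrow> real list \<Rightarrow> real) \<Rightarrow>
   (int \<Rightarrow> int \<Rightarrow> real) \<Rightarrow> (int \<Rightarrow> int \<Rightarrow> real) \<Rightarrow> int \<Rightarrow> int \<Rightarrow> real" where
  "mixed_flux k \<epsilon> d \<beta> U V i j =
     (let vt = v_interp k V i j;
          um = weno_right k \<epsilon> d \<beta> (\<lambda>m. U i (j - 1 + m));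
          up = weno_left k \<epsilon> d \<beta> (\<lambda>m. U i (j + m))
      in vt * (if vt < 0 then up else um))"

text \<open>
  The flux \<open>F\<^sup>u\<^sup>,\<^sup>x\<close> at \<open>(x\<^sub>i\<^sub>+\<^sub>1\<^sub>/\<^sub>2, y\<^sub>j\<^sub>+\<^sub>1\<^sub>/\<^sub>2)\<close>. The upwind direction is the sign of a numerical
  advection speed \<open>a\<close> computed from the row of \<open>u\<close>-values, indexed relative to the left
  neighbour of the interface. The scheme does not prescribe \<open>a\<close> (arithmetic mean, Roe speed,
  interpolated velocity, ...); \<open>upwind_speed\<close> only requires the correct sign for constant data.
\<close>

definition upwind_speed :: "((int \<Rightarrow> real) \<Rightarrow> real) \<Rightarrow> bool" where
  "upwind_speed a \<longleftrightarrow> (\<forall>c>0. a (\<lambda>_. c) > 0) \<and> (\<forall>c<0. a (\<lambda>_. c) < 0)"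

definition normal_flux ::
  "nat \<Rightarrow> real \<Rightarrow> (nat \<Rightarrow> real) \<Rightarrow> (nat \<Rightarrow> real list \<Rightarrow> real) \<Rightarrow> ((int \<Rightarrow> real) \<Rightarrow> real) \<Rightarrow>
   (int \<Rightarrow> int \<Rightarrow> real) \<Rightarrow> int \<Rightarrow> int \<Rightarrow> real" where
  "normal_flux k \<epsilon> d \<beta> a U i j =
     (if a (\<lambda>m. U (i + m) j) < 0
      then weno_left k \<epsilon> d \<beta> (\<lambda>m. (U (i + 1 + m) j)\<^sup>2)
      else weno_right k \<epsilon> d \<beta> (\<lambda>m. (U (i + m) j)\<^sup>2))"


section \<open>Truncation errors\<close>

definition node :: "real \<Rightarrow> real \<Rightarrow> real \<Rightarrow> real" where
  "node z0 h s = z0 + s * h"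

definition u_data ::
  "(real \<Rightarrow> real \<Rightarrow> real) \<Rightarrow> real \<Rightarrow> real \<Rightarrow> real \<Rightarrow> real \<Rightarrow> int \<Rightarrow> int \<Rightarrow> real" where
  "u_data u xmin ymin dx dy i j = u (node xmin dx (of_int i)) (node ymin dy (of_int j + 1 / 2))"

definition v_data ::
  "(real \<Rightarrow> real \<Rightarrow> real) \<Rightarrow> real \<Rightarrow> real \<Rightarrow> real \<Rightarrow> real \<Rightarrow> int \<Rightarrow> int \<Rightarrow> real" where
  "v_data v xmin ymin dx dy i j = v (node xmin dx (of_int i + 1 / 2)) (node ymin dy (of_int j))"

text \<open>The flux difference of the mixed flux against \<open>\<partial>\<^sub>y(uv)\<close> at \<open>(x\<^sub>i, y\<^sub>j\<^sub>+\<^sub>1\<^sub>/\<^sub>2)\<close>.\<close>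

definition flux_error ::
  "nat \<Rightarrow> real \<Rightarrow> (nat \<Rightarrow> real) \<Rightarrow> (nat \<Rightarrow> real list \<Rightarrow> real) \<Rightarrow>
   (real \<Rightarrow> real \<Rightarrow> real) \<Rightarrow> (real \<Rightarrow> real \<Rightarrow> real) \<Rightarrow>
   real \<Rightarrow> real \<Rightarrow> real \<Rightarrow> real \<Rightarrow> int \<Rightarrow> int \<Rightarrow> real" where
  "flux_error k \<epsilon> d \<beta> u v xmin ymin dx dy i j =
     (let U = u_data u xmin ymin dx dy;
          V = v_data v xmin ymin dx dy;
          x = node xmin dx (of_int i);
          y = node ymin dy (of_int j + 1 / 2)
      in (mixed_flux k \<epsilon> d \<beta> U V i (j + 1) - mixed_flux k \<epsilon> d \<beta> U V i j) / dy
         - deriv (\<lambda>s. u x s * v x s) y)"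

definition scheme_error_u ::
  "nat \<Rightarrow> real \<Rightarrow> (nat \<Rightarrow> real) \<Rightarrow> (nat \<Rightarrow> real list \<Rightarrow> real) \<Rightarrow> ((int \<Rightarrow> real) \<Rightarrow> real) \<Rightarrow>
   (real \<Rightarrow> real \<Rightarrow> real) \<Rightarrow> (real \<Rightarrow> real \<Rightarrow> real) \<Rightarrow>
   real \<Rightarrow> real \<Rightarrow> real \<Rightarrow> real \<Rightarrow> int \<Rightarrow> int \<Rightarrow> real" where
  "scheme_error_u k \<epsilon> d \<beta> a u v xmin ymin dx dy i j =
     (let U = u_data u xmin ymin dx dy;
          V = v_data v xmin ymin dx dy;
          x = node xmin dx (of_int i);
          y = node ymin dy (of_int j + 1 / 2)
      in (- (normal_flux k \<epsilon> d \<beta> a U i j - normal_flux k \<epsilon> d \<beta> a U (i - 1) j) / dx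
          - (mixed_flux k \<epsilon> d \<beta> U V i (j + 1) - mixed_flux k \<epsilon> d \<beta> U V i j) / dy)
         - (- deriv (\<lambda>s. (u s y)\<^sup>2) x - deriv (\<lambda>s. u x s * v x s) y))"

text \<open>
  The second equation is the first one with \<open>(u, x)\<close> and \<open>(v, y)\<close> interchanged. The reflection
  maps the \<open>v\<close>-nodes \<open>(x\<^sub>i\<^sub>+\<^sub>1\<^sub>/\<^sub>2, y\<^sub>j)\<close> to \<open>u\<close>-nodes and vice versa.
\<close>

definition scheme_error_v ::
  "nat \<Rightarrow> real \<Rightarrow> (nat \<Rightarrow> real) \<Rightarrow> (nat \<Rightarrow> real list \<Rightarrow> real) \<Rightarrow> ((int \<Rightarrow> real) \<Rightarrow> real) \<Rightarrow>
   (real \<Rightarrow> real \<Rightarrow> real) \<Rightarrow> (real \<Rightarrow> real \<Rightarrow> real) \<Rightarrow>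
   real \<Rightarrow> real \<Rightarrow> real \<Rightarrow> real \<Rightarrow> int \<Rightarrow> int \<Rightarrow> real" where
  "scheme_error_v k \<epsilon> d \<beta> a u v xmin ymin dx dy i j =
     scheme_error_u k \<epsilon> d \<beta> a (\<lambda>s t. v t s) (\<lambda>s t. u t s) ymin xmin dy dx j i"


section \<open>Order of accuracy\<close>

text \<open>
  \<open>error_order p s t e\<close>: at every fixed point \<open>(X, Y)\<close> of the plane, the error
  \<open>e xmin ymin dx dy i j\<close> is \<open>O(dx\<^sup>p + dy\<^sup>p)\<close> along all grids having \<open>(X, Y)\<close> as their node with
  index \<open>(i + s, j + t)\<close>. Only pointwise boundedness is asked for; a bound that is locally
  uniform in \<open>(X, Y)\<close> implies this one, so failing it is the stronger negative statement.
\<close>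

definition error_order ::
  "real \<Rightarrow> real \<Rightarrow> real \<Rightarrow> (real \<Rightarrow> real \<Rightarrow> real \<Rightarrow> real \<Rightarrow> int \<Rightarrow> int \<Rightarrow> real) \<Rightarrow> bool" where
  "error_order p s t e \<longleftrightarrow>
     (\<forall>X Y. \<exists>C. \<exists>\<delta>>0. \<forall>xmin ymin dx dy i j.
        0 < dx \<and> dx < \<delta> \<and> 0 < dy \<and> dy < \<delta> \<and>
        node xmin dx (of_int i + s) = X \<and> node ymin dy (of_int j + t) = Y \<longrightarrow>
        \<bar>e xmin ymin dx dy i j\<bar> \<le> C * (dx powr p + dy powr p))"

text \<open>
  Accuracy of order (at least) \<open>p\<close>. ``Sufficiently smooth'' is read as infinitely
  differentiable: this gives the largest possible set of exponents \<open>p\<close>, so an upper bound on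
  the order also holds for every class of finitely often differentiable functions.
\<close>

definition flux_has_order ::
  "nat \<Rightarrow> real \<Rightarrow> (nat \<Rightarrow> real) \<Rightarrow> (nat \<Rightarrow> real list \<Rightarrow> real) \<Rightarrow> real \<Rightarrow> bool" where
  "flux_has_order k \<epsilon> d \<beta> p \<longleftrightarrow>
     (\<forall>u v. smooth2 u \<and> smooth2 v \<longrightarrow> error_order p 0 (1 / 2) (flux_error k \<epsilon> d \<beta> u v))"

definition scheme_has_order ::
  "nat \<Rightarrow> real \<Rightarrow> (nat \<Rightarrow> real) \<Rightarrow> (nat \<Rightarrow> real list \<Rightarrow> real) \<Rightarrow> ((int \<Rightarrow> real) \<Rightarrow> real) \<Rightarrow>
   real \<Rightarrow> bool" where
  "scheme_has_order k \<epsilon> d \<beta> a p \<longleftrightarrow>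
     (\<forall>u v. smooth2 u \<and> smooth2 v \<longrightarrow>
        error_order p 0 (1 / 2) (scheme_error_u k \<epsilon> d \<beta> a u v) \<and>
        error_order p (1 / 2) 0 (scheme_error_v k \<epsilon> d \<beta> a u v))"

end

theory Submission
  imports Defs
begin

text \<open>
  For constant \<open>u\<close> the WENO reconstructions and the interpolation in \<open>x\<close> are exact whatever the
  nonlinear weights do, so for \<open>v = v(y)\<close> the flux difference is the plain central difference of
  \<open>v\<close> over one cell. Taking \<open>u = 1\<close> and \<open>v = y\<^sup>3\<close>, its error at the origin is exactly
  \<open>\<Delta>y\<^sup>2 / 4\<close>, and the normal flux does not contribute to the truncation error.
\<close>

text \<open>The mean value theorem for the antiderivative \<open>F\<close> turns a vanishing
  integral into a zero of \<open>f\<close>. The zero lies strictly inside the interval, so zeros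
  obtained from adjacent cells cannot coincide.\<close>

lemma integral_zero_imp_root:
  fixes f :: "real \<Rightarrow> real"
  assumes "a < b" "continuous_on {a..b} f" "integral {a..b} f = 0"
  shows "\<exists>x. a < x \<and> x < b \<and> f x = 0"
proof -
  define F where "F = (\<lambda>t. integral {a..t} f)"
  have d: "(F has_real_derivative f t) (at t within {a..b})" if "t \<in> {a..b}" for t
    unfolding F_def using integral_has_real_derivative[OF assms(2) that] .
  have "continuous_on {a..b} F"
    using d by (meson DERIV_continuous continuous_on_eq_continuous_within)
  moreover have "(F has_derivative (\<lambda>h. f t * h)) (at t)" if "a < t" "t < b" for t
    using d[of t] that
    by (simp add: has_field_derivative_def at_within_Icc_at)
  ultimately obtain x where "a < x" "x < b" "F b - F a = f x * (b - a)"
    using mvt[OF assms(1), of F "\<lambda>t h. f t * h"] by blast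
  moreover have "F b - F a = 0"
    using assms(3) by (simp add: F_def)
  ultimately show ?thesis
    using assms(1) by auto
qed

text \<open>Each of the \<open>k\<close> disjoint open cells contains a root of \<open>p\<close>,
  too many for a nonzero polynomial of degree at most \<open>k - 1\<close>. This is the uniqueness
  behind the definite description in \<open>stencil_poly\<close>.\<close>

lemma poly_zero_cell_averages:
  assumes "k \<ge> 1" "degree p \<le> k - 1"
    and avg: "\<And>l. l < k \<Longrightarrow> cell_average (poly p) 1 (of_int (int l - int r)) = 0"
  shows "p = 0"
proof (rule ccontr)
  assume "p \<noteq> 0"
  have "\<exists>x. of_int (int l - int r) - 1/2 < x \<and> x < of_int (int l - int r) + 1/2 \<and> poly p x = 0"
    if "l < k" for l
    using avg[OF that] unfolding cell_average_def
    by (intro integral_zero_imp_root) (auto intro!: continuous_intros)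
  then obtain z where z: "\<And>l. l < k \<Longrightarrow> real l - real r - 1/2 < z l \<and>
      z l < real l - real r + 1/2 \<and> poly p (z l) = 0"
    by (metis of_int_diff of_int_of_nat_eq)
  have "inj_on z {..<k}"
  proof (rule inj_onI)
    fix l m assume "l \<in> {..<k}" "m \<in> {..<k}" "z l = z m"
    \<comment> \<open>A common root would lie within 1/2 of both cell centres, and these differ by
      the integer \<open>l - m\<close>.\<close>
    then have "\<bar>real l - real m\<bar> < 1"
      using z[of l] z[of m] by (simp add: abs_less_iff)
    then show "l = m" by linarith
  qed
  then have "k = card (z ` {..<k})"
    by (simp add: card_image)
  also have "\<dots> \<le> card {x. poly p x = 0}"
    using z \<open>p \<noteq> 0\<close> by (intro card_mono poly_roots_finite) auto
  also have "\<dots> \<le> k - 1"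
    using card_poly_roots_bound[OF \<open>p \<noteq> 0\<close>] assms(2) by linarith
  finally show False
    using assms(1) by simp
qed

lemma stencil_value_const:
  assumes "k \<ge> 1"
  shows "stencil_value k r (\<lambda>_. c) = c"
proof -
  have "p = [:c:]" if "degree p \<le> k - 1"
    and avg: "\<forall>l<k. cell_average (poly p) 1 (of_int (int l - int r)) = c" for p
  proof -
    have "p - [:c:] = 0"
    proof (rule poly_zero_cell_averages[OF assms])
      show "degree (p - [:c:]) \<le> k - 1"
        using that(1) by (intro degree_diff_le) auto
      show "cell_average (poly (p - [:c:])) 1 (of_int (int l - int r)) = 0" if "l < k" for l
      proof -
        have "poly (p - [:c:]) = (\<lambda>x. poly p x - c)"
          by auto
        moreover have "integral {a..b} (\<lambda>x. poly p x - c) = integral {a..b} (poly p) - integral {a..b} (\<lambda>_. c)" for a b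
          by (intro integral_diff integrable_continuous_real continuous_intros)
        ultimately show ?thesis
          using avg that by (simp add: cell_average_def)
      qed
    qed
    then show ?thesis by simp
  qed
  moreover have "poly [:c:] = (\<lambda>_. c)"
    by auto
  ultimately have "stencil_poly k r (\<lambda>_. c) = [:c:]"
    unfolding stencil_poly_def by (intro the_equality) (auto simp: cell_average_def)
  then show ?thesis
    by (simp add: stencil_value_def)
qed

text \<open>All candidate values equal \<open>c\<close>, so only the normalization of the weights
  matters. Positivity of every \<open>A r\<close> keeps the denominator away from 0, and the weights
  then sum to 1.\<close>

lemma weno_right_const:
  assumes "k \<ge> 1" "\<epsilon> > 0" "\<And>r. r < k \<Longrightarrow> d r > 0"
    and "\<And>r ws. r < k \<Longrightarrow> length ws = k \<Longrightarrow> \<beta> r ws \<ge> 0"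
  shows "weno_right k \<epsilon> d \<beta> (\<lambda>_. c) = c"
proof -
  define A where "A = weno_alpha k \<epsilon> d \<beta> (\<lambda>_. c)"
  have "A r > 0" if "r < k" for r
    using assms(3)[OF that] assms(4)[OF that, of "map (\<lambda>_. c) [0..<k]"] assms(2)
    by (simp add: A_def weno_alpha_def)
  then have "sum A {..<k} > 0"
    using assms(1) by (intro sum_pos) (auto simp: lessThan_empty_iff)
  then show ?thesis
    by (simp add: weno_right_def weno_weight_def stencil_value_const[OF assms(1)] A_def
        flip: sum_distrib_right sum_divide_distrib)
qed

lemma weno_left_const:
  assumes "k \<ge> 1" "\<epsilon> > 0" "\<And>r. r < k \<Longrightarrow> d r > 0"
    and "\<And>r ws. r < k \<Longrightarrow> length ws = k \<Longrightarrow> \<beta> r ws \<ge> 0"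
  shows "weno_left k \<epsilon> d \<beta> (\<lambda>_. c) = c"
  unfolding weno_left_def by (rule weno_right_const[OF assms])

text \<open>The 2k half-integer nodes are distinct, which forces uniqueness in degree at most 2k -
  1. Constancy is asked only along row \<open>j\<close>, leaving \<open>v\<close> free to vary with
  y.\<close>

lemma v_interp_const:
  assumes "k \<ge> 1" "\<And>l. V l j = c"
  shows "v_interp k V i j = c"
proof -
  have "p = [:c:]" if "degree p \<le> 2 * k - 1"
    and val: "\<forall>l\<in>{- int k + 1 .. int k}. poly p (of_int l - 1 / 2) = V (i - 1 + l) j" for p
  proof (rule ccontr)
    assume "p \<noteq> [:c:]"
    then have nz: "p - [:c:] \<noteq> 0" by simp
    have "2 * k = card ((\<lambda>l. real_of_int l - 1 / 2) ` {- int k + 1 .. int k})"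
      by (subst card_image) (auto simp: inj_on_def)
    also have "\<dots> \<le> card {x. poly (p - [:c:]) x = 0}"
      using val assms(2) by (intro card_mono poly_roots_finite[OF nz]) auto
    also have "\<dots> \<le> degree (p - [:c:])"
      by (rule card_poly_roots_bound[OF nz])
    also have "\<dots> \<le> 2 * k - 1"
      using that(1) by (intro degree_diff_le) auto
    finally show False
      using assms(1) by simp
  qed
  then have "interp_poly k V i j = [:c:]"
    unfolding interp_poly_def using assms(2) by (intro the_equality) auto
  then show ?thesis
    by (simp add: v_interp_def)
qed

lemma smooth2_monomial_snd: "smooth2 (\<lambda>_ y. c * y ^ m)"
proof -
  have "cont_diff2 n (\<lambda>_ y. c * y ^ m)" for n
  proof (induction n arbitrary: c m)
    case 0
    show ?case
      by (auto simp: case_prod_unfold intro!: continuous_intros)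
  next
    case (Suc n)
    have "continuous_on UNIV (\<lambda>(x, y). c * y ^ m)"
      by (auto simp: case_prod_unfold intro!: continuous_intros)
    \<comment> \<open>Zero is written as a monomial so that the induction hypothesis, general in
      \<open>c\<close> and \<open>m\<close>, covers both partial derivatives.\<close>
    moreover have "((\<lambda>s. c * y ^ m) has_real_derivative 0 * y ^ 0) (at x)" for x y :: real
      by simp
    moreover have "((\<lambda>s. c * s ^ m) has_real_derivative (c * real m) * y ^ (m - 1)) (at y)" for y
      by (auto intro!: derivative_eq_intros)
    ultimately show ?case
      unfolding cont_diff2.simps
      by (intro conjI exI[of _ "\<lambda>_ y. 0 * y ^ 0"] exI[of _ "\<lambda>_ y. (c * real m) * y ^ (m - 1)"]
          allI Suc) auto
  qed
  then show ?thesis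
    by (simp add: smooth2_def)
qed

text \<open>The bound is tested at the origin on square grids with \<open>dx = dy = h\<close> and
  indices 0. The shifts \<open>- s * h\<close> and \<open>- t * h\<close> place the relevant node
  exactly at the origin.\<close>

lemma error_order_quadratic_error:
  assumes "error_order p s t e"
    and err: "\<And>h. h > 0 \<Longrightarrow> \<bar>e (- s * h) (- t * h) h h 0 0\<bar> = h\<^sup>2 / 4"
  shows "p \<le> 2"
proof (rule ccontr)
  assume "\<not> p \<le> 2"
  then have p: "p - 2 > 0" by simp
  obtain C \<delta> where "\<delta> > 0" and bound: "\<And>xmin ymin dx dy i j.
        0 < dx \<and> dx < \<delta> \<and> 0 < dy \<and> dy < \<delta> \<and>
        node xmin dx (of_int i + s) = 0 \<and> node ymin dy (of_int j + t) = 0 \<longrightarrow>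
        \<bar>e xmin ymin dx dy i j\<bar> \<le> C * (dx powr p + dy powr p)"
    using assms(1) unfolding error_order_def by metis
  \<comment> \<open>This is the assumed bound divided by \<open>h\<^sup>2\<close>; its right side
    tends to 0 when p > 2.\<close>
  have le: "1 / 4 \<le> 2 * C * h powr (p - 2)" if "0 < h" "h < \<delta>" for h
  proof -
    have "h\<^sup>2 / 4 \<le> C * (h powr p + h powr p)"
      using bound[of h h "- s * h" 0 "- t * h" 0] err[of h] that by (simp add: node_def)
    also have "h powr p = h\<^sup>2 * h powr (p - 2)"
      using that by (simp add: powr_diff)
    finally have "h\<^sup>2 * (1 / 4) \<le> h\<^sup>2 * (2 * C * h powr (p - 2))"
      by (simp add: algebra_simps)
    then show ?thesis
      using that by (simp only: mult_le_cancel_left_pos zero_less_power)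
  qed
  have "((\<lambda>h. h powr (p - 2)) \<longlongrightarrow> 0) (at_right 0)"
    using p by (intro tendsto_zero_powrI[where b = "p - 2"])
      (auto intro: tendsto_eq_intros simp: eventually_at_right_less less_imp_le eventually_at_filter)
  then have "((\<lambda>h. 2 * C * h powr (p - 2)) \<longlongrightarrow> 2 * C * 0) (at_right 0)"
    by (intro tendsto_intros)
  moreover have "\<forall>\<^sub>F h in at_right 0. 1 / 4 \<le> 2 * C * h powr (p - 2)"
    using le \<open>\<delta> > 0\<close> unfolding eventually_at_right_field by blast
  ultimately have "1 / 4 \<le> 2 * C * 0"
    by (intro tendsto_lowerbound) auto
  then show False by simp
qed

text \<open>Both upwind candidates for \<open>u\<close> equal 1, so the sign change of
  \<open>v\<close> at y = 0 is harmless and the flux is the interpolated velocity itself.\<close>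

lemma mixed_flux_const_cubic:
  assumes "k \<ge> 1" "\<epsilon> > 0" "\<And>r. r < k \<Longrightarrow> d r > 0"
    and "\<And>r ws. r < k \<Longrightarrow> length ws = k \<Longrightarrow> \<beta> r ws \<ge> 0"
  shows "mixed_flux k \<epsilon> d \<beta> (u_data (\<lambda>_ _. 1) xmin ymin dx dy)
           (v_data (\<lambda>_ y. y ^ 3) xmin ymin dx dy) i j = (node ymin dy (of_int j)) ^ 3"
proof -
  have "v_interp k (v_data (\<lambda>_ y. y ^ 3) xmin ymin dx dy) i j = (node ymin dy (of_int j)) ^ 3"
    by (rule v_interp_const[OF assms(1)]) (simp add: v_data_def)
  then show ?thesis
    by (simp add: mixed_flux_def u_data_def weno_right_const[OF assms] weno_left_const[OF assms])
qed

text \<open>With \<open>ymin = - (h / 2)\<close> the two faces lie at -h/2 and h/2, symmetric about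
  the origin. The derivative of the cubic vanishes there, so the difference quotient is the entire
  error.\<close>

lemma flux_error_const_cubic:
  assumes "k \<ge> 1" "\<epsilon> > 0" "\<And>r. r < k \<Longrightarrow> d r > 0"
    and "\<And>r ws. r < k \<Longrightarrow> length ws = k \<Longrightarrow> \<beta> r ws \<ge> 0" "h > 0"
  shows "flux_error k \<epsilon> d \<beta> (\<lambda>_ _. 1) (\<lambda>_ y. y ^ 3) 0 (- (h / 2)) h h 0 0 = h\<^sup>2 / 4"
proof -
  have "((\<lambda>s::real. s ^ 3) has_real_derivative 0) (at 0)"
    by (auto intro!: derivative_eq_intros)
  then have "deriv (\<lambda>s::real. s ^ 3) 0 = 0"
    by (rule DERIV_imp_deriv)
  then have "flux_error k \<epsilon> d \<beta> (\<lambda>_ _. 1) (\<lambda>_ y. y ^ 3) 0 (- (h / 2)) h h 0 0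
      = ((h / 2) ^ 3 - (- (h / 2)) ^ 3) / h"
    by (simp add: flux_error_def Let_def mixed_flux_const_cubic[OF assms(1-4)] node_def)
  also have "\<dots> = h\<^sup>2 / 4"
    using assms(5) by (simp add: field_simps power2_eq_square power3_eq_cube)
  finally show ?thesis .
qed

text \<open>Either branch of the normal flux returns \<open>c\<^sup>2\<close>, so its difference
  cancels, as does the x-derivative of the constant. The sign flips because the flux divergence
  enters the equation with a minus.\<close>

lemma scheme_error_u_const:
  assumes "k \<ge> 1" "\<epsilon> > 0" "\<And>r. r < k \<Longrightarrow> d r > 0"
    and "\<And>r ws. r < k \<Longrightarrow> length ws = k \<Longrightarrow> \<beta> r ws \<ge> 0"
  shows "scheme_error_u k \<epsilon> d \<beta> a (\<lambda>_ _. c) v xmin ymin dx dy i j =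
           - flux_error k \<epsilon> d \<beta> (\<lambda>_ _. c) v xmin ymin dx dy i j"
  by (simp add: scheme_error_u_def flux_error_def Let_def normal_flux_def u_data_def
      weno_right_const[OF assms] weno_left_const[OF assms])

theorem theorem1:
  fixes k :: nat
    and \<epsilon> :: real
    and d :: "nat \<Rightarrow> real"
    and \<beta> :: "nat \<Rightarrow> real list \<Rightarrow> real"
    and a :: "(int \<Rightarrow> real) \<Rightarrow> real"
  assumes "k \<ge> 2"
    and "\<epsilon> > 0"
    and "linear_weights k d"
    and "\<And>r ws. r < k \<Longrightarrow> length ws = k \<Longrightarrow> \<beta> r ws \<ge> 0"
    and "upwind_speed a"
  shows "(\<forall>p. flux_has_order k \<epsilon> d \<beta> p \<longrightarrow> p \<le> 2) \<and>
         (\<forall>p. scheme_has_order k \<epsilon> d \<beta> a p \<longrightarrow> p \<le> 2) \<and>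
         \<not> (\<forall>u v. smooth2 u \<and> smooth2 v \<longrightarrow>
              error_order (of_nat (2 * k - 1)) 0 (1 / 2) (flux_error k \<epsilon> d \<beta> u v))"
proof -
  have k: "k \<ge> 1"
    using assms(1) by simp
  have d: "\<And>r. r < k \<Longrightarrow> d r > 0"
    using assms(3) by (simp add: linear_weights_def)
  note weno = k assms(2) d assms(4)
  have smooth: "smooth2 (\<lambda>_ _. 1)" "smooth2 (\<lambda>_ y. y ^ 3)"
    using smooth2_monomial_snd[of 1 0] smooth2_monomial_snd[of 1 3] by simp_all
  have flux: "p \<le> 2" if "flux_has_order k \<epsilon> d \<beta> p" for p
  proof (rule error_order_quadratic_error)
    show "error_order p 0 (1 / 2) (flux_error k \<epsilon> d \<beta> (\<lambda>_ _. 1) (\<lambda>_ y. y ^ 3))"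
      using that smooth by (simp add: flux_has_order_def)
  qed (simp add: flux_error_const_cubic[OF weno])
  moreover have "p \<le> 2" if "scheme_has_order k \<epsilon> d \<beta> a p" for p
  proof (rule error_order_quadratic_error)
    show "error_order p 0 (1 / 2) (scheme_error_u k \<epsilon> d \<beta> a (\<lambda>_ _. 1) (\<lambda>_ y. y ^ 3))"
      using that smooth by (simp add: scheme_has_order_def)
  qed (simp add: flux_error_const_cubic[OF weno] scheme_error_u_const[OF weno])
  \<comment> \<open>For k at least 2 the claimed exponent 2k - 1 is at least 3, beyond the bound
    just proved.\<close>
  moreover have "\<not> flux_has_order k \<epsilon> d \<beta> (of_nat (2 * k - 1))"
    using flux[of "of_nat (2 * k - 1)"] assms(1) by auto
  ultimately show ?thesis
    unfolding flux_has_order_def by blast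
qed

end
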